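(* For $q\in(1,\infty)$ let $$c_q=\frac{\big(\mathbb{E}|Z|^{\frac{2-q}{q-1}}\big)^2}{(q-1)^2\,\mathbb{E}|Z|^{\frac{2}{q-1}}},$$ where $Z\sim N(0,1)$. Then the maximum of $c_q$ over $q\in(1,\infty)$ is achieved at $q=2$.
   Context: $Z$ is a standard normal random variable. *)

theory Defs
  imports "HOL-Probability.Probability"
begin

text \<open>
  For \<^term>\<open>q > (1::real)\<close> both exponents exceed \<open>- 1\<close> (the first one is \<open>1 / (q - 1) - 1\<close>), so for
  standard normal \<open>Z\<close> both moments are finite and the Bochner integrals do not take their default
  value 0. The only other convention is \<open>0 powr a = 0\<close>, which concerns the null event \<open>Z = 0\<close>.
\<close>

definition c_const :: "'a measure \<Rightarrow> ('a \<Rightarrow> real) \<Rightarrow> real \<Rightarrow> real" where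
  "c_const M Z q =
     (\<integral>\<omega>. \<bar>Z \<omega>\<bar> powr ((2 - q) / (q - 1)) \<partial>M)\<^sup>2 /
     ((q - 1)\<^sup>2 * (\<integral>\<omega>. \<bar>Z \<omega>\<bar> powr (2 / (q - 1)) \<partial>M))"

end

theory Submission
  imports Defs
begin

text \<open>
  Put \<open>p = 1 / (q - 1)\<close>, so that \<open>p\<close> runs through \<open>(0, \<infinity>)\<close> and \<open>q = 2\<close> corresponds to \<open>p = 1\<close>.
  The quantity to be maximised becomes \<open>(p E\<bar>Z\<bar>\<^sup>p\<^sup>-\<^sup>1)\<^sup>2 / E\<bar>Z\<bar>\<^sup>2\<^sup>p\<close>. Gaussian integration by parts
  (lemma \<open>std_normal_abs_powr_recurrence\<close>) absorbs the factor: \<open>p E\<bar>Z\<bar>\<^sup>p\<^sup>-\<^sup>1 = E\<bar>Z\<bar>\<^sup>p\<^sup>+\<^sup>1\<close>. Since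
  \<open>\<bar>Z\<bar>\<^sup>p\<^sup>+\<^sup>1 = \<bar>Z\<bar>\<^sup>p \<bar>Z\<bar>\<close>, the Cauchy-Schwarz inequality gives
  \<open>(E\<bar>Z\<bar>\<^sup>p\<^sup>+\<^sup>1)\<^sup>2 \<le> E\<bar>Z\<bar>\<^sup>2\<^sup>p E Z\<^sup>2 = E\<bar>Z\<bar>\<^sup>2\<^sup>p\<close>, so the quotient is at most 1, and at \<open>p = 1\<close> it
  equals 1.

  Both steps need the moments to be finite, which lemma \<open>integrable_std_normal_abs_powr\<close>
  provides for all exponents above \<open>-1\<close>.
\<close>

lemma integrable_abs_powr_near_0:
  fixes a :: real
  assumes "a > -1"
  shows "integrable lborel (\<lambda>x. indicator {-1<..<1} x * \<bar>x\<bar> powr a)"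
proof -
  have "set_integrable lborel (einterval 0 1) (\<lambda>x. x powr a)"
  proof (rule interval_integral_FTC_nonneg[where F = "\<lambda>x. x powr (a + 1) / (a + 1)" and A = 0
        and B = "1 / (a + 1)"])
    show "(((\<lambda>x. x powr (a + 1) / (a + 1)) \<circ> real_of_ereal) \<longlongrightarrow> 0) (at_right 0)"
      unfolding zero_ereal_def ereal_tendsto_simps1 using assms by real_asymp
    show "(((\<lambda>x. x powr (a + 1) / (a + 1)) \<circ> real_of_ereal) \<longlongrightarrow> 1 / (a + 1)) (at_left 1)"
      unfolding one_ereal_def ereal_tendsto_simps1 using assms
      by (auto intro!: tendsto_eq_intros)
  qed (use assms in \<open>auto intro!: derivative_eq_intros continuous_intros\<close>)
  moreover have "(\<lambda>x. indicator (einterval 0 1) x *\<^sub>R x powr a)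
      = (\<lambda>x::real. indicator {0..} x *\<^sub>R (indicator {-1<..<1} x * \<bar>x\<bar> powr a))"
    by (auto simp: fun_eq_iff indicator_def einterval_def)
  ultimately have "integrable lborel
      (\<lambda>x::real. indicator {0..} x *\<^sub>R (indicator {-1<..<1} x * \<bar>x\<bar> powr a))"
    by (simp add: set_integrable_def)
  from has_bochner_integral_integrable[OF this] show ?thesis
    by (rule integrable.intros[OF has_bochner_integral_even_function]) (auto simp: indicator_def)
qed

lemma std_normal_density_le_1: "std_normal_density x \<le> 1"
proof -
  have "1 \<le> sqrt (2 * pi)" using pi_gt3 by simp
  moreover have "exp (- x\<^sup>2 / 2) \<le> 1" by simp
  ultimately have "exp (- x\<^sup>2 / 2) \<le> sqrt (2 * pi)" by linarith
  then show ?thesis unfolding std_normal_density_def by simp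
qed

text \<open>
  The singularity of \<open>\<bar>x\<bar>\<^sup>a\<close> for negative \<open>a\<close> only matters on \<open>(-1, 1)\<close>, where the density is
  bounded; elsewhere \<open>\<bar>x\<bar>\<^sup>a\<close> is dominated by a natural power, whose Gaussian moment is finite.
\<close>

lemma integrable_std_normal_abs_powr:
  fixes a :: real
  assumes "a > -1"
  shows "integrable lborel (\<lambda>x. std_normal_density x * \<bar>x\<bar> powr a)"
proof -
  define n where "n = nat \<lceil>a\<rceil>"
  have "a \<le> n" unfolding n_def by linarith
  have "std_normal_density x * \<bar>x\<bar> powr a
      \<le> indicator {-1<..<1} x * \<bar>x\<bar> powr a + std_normal_density x * \<bar>x\<bar> ^ n" for x
  proof (cases "\<bar>x\<bar> < 1")
    case True
    then have "std_normal_density x * \<bar>x\<bar> powr a \<le> indicator {-1<..<1} x * \<bar>x\<bar> powr a"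
      by (intro mult_right_mono)
         (auto simp: indicator_def std_normal_density_le_1 abs_if split: if_splits)
    then show ?thesis
      by (smt (verit) normal_density_nonneg zero_le_power mult_nonneg_nonneg abs_ge_zero)
  next
    case False
    then have "\<bar>x\<bar> powr a \<le> \<bar>x\<bar> ^ n"
      using powr_mono[OF \<open>a \<le> n\<close>, of "\<bar>x\<bar>"] powr_realpow[of "\<bar>x\<bar>" n] by simp
    then show ?thesis
      by (simp add: mult_left_mono add_increasing)
  qed
  then show ?thesis
    by (intro Bochner_Integration.integrable_bound[OF Bochner_Integration.integrable_add[OF
          integrable_abs_powr_near_0[OF assms] integrable_std_normal_moment_abs[of n]]]) auto
qed

lemma DERIV_std_normal_density:
  "(std_normal_density has_real_derivative - x * std_normal_density x) (at x)"
proof -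
  have "((\<lambda>x. exp (- x\<^sup>2 / 2)) has_real_derivative - x * exp (- x\<^sup>2 / 2)) (at x)"
    by (auto intro!: derivative_eq_intros)
  from DERIV_cmult[OF this, of "1 / sqrt (2 * pi)"] show ?thesis
    unfolding std_normal_density_def[abs_def] by (simp add: mult.left_commute)
qed

text \<open>
  With \<open>\<phi>\<close> the density, \<open>\<phi>'(x) = - x \<phi>(x)\<close> makes \<open>\<phi>(x) (p x\<^sup>p\<^sup>-\<^sup>1 - x\<^sup>p\<^sup>+\<^sup>1)\<close> the derivative of
  \<open>\<phi>(x) x\<^sup>p\<close> on the positive half-line. As \<open>p > 0\<close>, the boundary terms at 0 and at infinity both
  vanish, and by symmetry so does the integral over the whole line.
\<close>

lemma std_normal_abs_powr_recurrence:
  fixes p :: real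
  assumes "p > 0"
  shows "(\<integral>x. std_normal_density x * \<bar>x\<bar> powr (p + 1) \<partial>lborel)
       = p * (\<integral>x. std_normal_density x * \<bar>x\<bar> powr (p - 1) \<partial>lborel)"
proof -
  define f :: "real \<Rightarrow> real" where
    "f x = p * (std_normal_density x * \<bar>x\<bar> powr (p - 1))
         - std_normal_density x * \<bar>x\<bar> powr (p + 1)" for x
  have int: "integrable lborel (\<lambda>x. std_normal_density x * \<bar>x\<bar> powr (p - 1))"
    "integrable lborel (\<lambda>x. std_normal_density x * \<bar>x\<bar> powr (p + 1))"
    by (rule integrable_std_normal_abs_powr; use assms in simp)+
  then have int_f: "integrable lborel f"
    unfolding f_def by (intro Bochner_Integration.integrable_diff integrable_mult_right)
  have "(LBINT x=0..\<infinity>. f x) = 0 - 0"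
  proof (rule interval_integral_FTC_integrable)
    fix x :: real assume "0 < ereal x"
    then have x: "x > 0" by simp
    have "((\<lambda>x. std_normal_density x * x powr p) has_real_derivative f x) (at x)"
      using DERIV_mult[OF DERIV_std_normal_density has_real_derivative_powr[OF x, of p]]
      by (rule DERIV_cong) (use x in \<open>simp add: f_def powr_add algebra_simps\<close>)
    then show "((\<lambda>x. std_normal_density x * x powr p) has_vector_derivative f x) (at x)"
      by (simp add: has_real_derivative_iff_has_vector_derivative)
    show "isCont f x"
      unfolding std_normal_density_def f_def using x by (auto intro!: continuous_intros)
  next
    show "set_integrable lborel (einterval 0 \<infinity>) f"
      unfolding set_integrable_def by (intro integrable_mult_indicator int_f) auto
    show "(((\<lambda>x. std_normal_density x * x powr p) \<circ> real_of_ereal) \<longlongrightarrow> 0) (at_right 0)"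
      unfolding zero_ereal_def ereal_tendsto_simps1 std_normal_density_def
      using assms by real_asymp
    show "(((\<lambda>x. std_normal_density x * x powr p) \<circ> real_of_ereal) \<longlongrightarrow> 0) (at_left \<infinity>)"
      unfolding ereal_tendsto_simps1 std_normal_density_def by real_asymp
  qed simp
  also have "(LBINT x=0..\<infinity>. f x) = (\<integral>x. indicator {0..} x *\<^sub>R f x \<partial>lborel)"
    unfolding interval_lebesgue_integral_def set_lebesgue_integral_def
    \<comment> \<open>The intervals differ in the point 0, where \<^term>\<open>f\<close> is 0 because of \<open>0 powr a = 0\<close>.\<close>
    by (auto intro!: Bochner_Integration.integral_cong simp: einterval_def indicator_def f_def)
  finally have "has_bochner_integral lborel (\<lambda>x. indicator {0..} x *\<^sub>R f x) 0"
    using has_bochner_integral_integrable[OF integrable_mult_indicator[OF _ int_f, of "{0..}"]]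
    by simp
  then have "has_bochner_integral lborel f (2 *\<^sub>R 0)"
    by (rule has_bochner_integral_even_function) (simp add: f_def std_normal_density_def)
  then have "(\<integral>x. f x \<partial>lborel) = 0"
    by (simp add: has_bochner_integral_integral_eq)
  then show ?thesis unfolding f_def using int by simp
qed

theorem lemma3p1:
  fixes M :: "'a measure" and Z :: "'a \<Rightarrow> real"
  assumes "prob_space M"
    and "distributed M lborel Z (\<lambda>x. ennreal (std_normal_density x))"
  shows "\<forall>q::real \<in> {1<..}. c_const M Z q \<le> c_const M Z 2"
proof
  fix q :: real
  assume "q \<in> {1<..}"
  then have q: "q > 1" by simp
  define p where "p = 1 / (q - 1)"
  have p: "p > 0" using q by (simp add: p_def)
  define E where "E a = (\<integral>\<omega>. \<bar>Z \<omega>\<bar> powr a \<partial>M)" for a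
  have E_eq: "E a = (\<integral>x. std_normal_density x * \<bar>x\<bar> powr a \<partial>lborel)" for a
    unfolding E_def by (rule distributed_integral[OF assms(2), symmetric]) auto
  have int: "integrable M (\<lambda>\<omega>. \<bar>Z \<omega>\<bar> powr a)" if "a > -1" for a
    using distributed_integrable[OF assms(2), of "\<lambda>x. \<bar>x\<bar> powr a"]
      integrable_std_normal_abs_powr[OF that]
    by simp
  have E2: "E 2 = 1"
    using integral_std_normal_moment_even[of 1] by (simp add: E_eq)
  \<comment> \<open>The integrand \<open>\<bar>x\<bar> powr 0\<close> is 1 only away from 0.\<close>
  have "AE x in lborel. std_normal_density x * \<bar>x\<bar> powr 0 = std_normal_density x"
    using AE_lborel_singleton[of 0] by eventually_elim simp
  then have "E 0 = (\<integral>x. std_normal_density x \<partial>lborel)"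
    unfolding E_eq by (intro integral_cong_AE) measurable
  then have E0: "E 0 = 1" by simp
  have "c_const M Z q = (E (p - 1))\<^sup>2 / ((1 / p)\<^sup>2 * E (2 * p))"
  proof -
    have "(2 - q) / (q - 1) = p - 1" "2 / (q - 1) = 2 * p" "q - 1 = 1 / p"
      using q by (simp_all add: p_def field_simps)
    then show ?thesis unfolding c_const_def E_def by simp
  qed
  also have "\<dots> = (p * E (p - 1))\<^sup>2 / E (2 * p)"
    using p by (simp add: field_simps)
  also have "p * E (p - 1) = E (p + 1)"
    unfolding E_eq using std_normal_abs_powr_recurrence[OF p] by simp
  also have "(E (p + 1))\<^sup>2 / E (2 * p) \<le> 1"
  proof -
    \<comment> \<open>Cauchy-Schwarz for \<open>\<bar>Z\<bar>\<^sup>p\<close> and \<open>\<bar>Z\<bar>\<close>: since \<open>E Z\<^sup>2 = 1\<close>, the orthogonal projection of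
        \<open>\<bar>Z\<bar>\<^sup>p\<close> onto the line of \<open>\<bar>Z\<bar>\<close> is \<open>?t \<bar>Z\<bar>\<close>; the squared norm of the remainder
        is nonnegative.\<close>
    let ?t = "E (p + 1)"
    have sq: "(\<bar>x\<bar> powr p - ?t * \<bar>x\<bar>)\<^sup>2
        = \<bar>x\<bar> powr (2 * p) - 2 * ?t * \<bar>x\<bar> powr (p + 1) + ?t\<^sup>2 * \<bar>x\<bar> powr 2" for x
    proof -
      have "\<bar>x\<bar> powr (2 * p) = (\<bar>x\<bar> powr p)\<^sup>2" "\<bar>x\<bar> powr (p + 1) = \<bar>x\<bar> powr p * \<bar>x\<bar>"
        using powr_add[of "\<bar>x\<bar>" p p] by (simp_all add: powr_add power2_eq_square)
      then show ?thesis by (simp add: power2_diff power_mult_distrib)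
    qed
    have "0 \<le> (\<integral>\<omega>. (\<bar>Z \<omega>\<bar> powr p - ?t * \<bar>Z \<omega>\<bar>)\<^sup>2 \<partial>M)" by simp
    also have "\<dots> = E (2 * p) - 2 * ?t * E (p + 1) + ?t\<^sup>2 * E 2"
      unfolding sq using p int[of "2 * p"] int[of "p + 1"] int[of 2]
      by (simp add: E_def del: powr_numeral)
    finally have "(E (p + 1))\<^sup>2 \<le> E (2 * p)"
      by (simp add: E2 power2_eq_square)
    moreover have "E (2 * p) \<ge> 0" by (simp add: E_def)
    ultimately show ?thesis by (simp add: divide_le_eq_1 order_less_le)
  qed
  also have "1 = c_const M Z 2"
    using E0 E2 by (simp add: c_const_def E_def)
  finally show "c_const M Z q \<le> c_const M Z 2" .
qed

end
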